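(* Let $G$ be a group, $R$ a $G$-graded commutative ring with identity, $M$ and $M'$ two graded $R$-modules, and $N'$ a graded submodule of $M'$. Let $\varphi:M\to M'$ be a graded epimorphism. If $N'$ is a graded primary-like submodule of $M'$, then $\varphi^{-1}(N')$ is a graded primary-like submodule of $M$.
   Context: All rings are commutative with identity and all modules are unitary. $R=\bigoplus_{g\in G}R_g$ is $G$-graded with $R_gR_h\subseteq R_{gh}$; a graded $R$-module is $M=\bigoplus_{g\in G}M_g$ with $R_gM_h\subseteq M_{gh}$; $h(R)=\bigcup_g R_g$ and $h(M)=\bigcup_g M_g$. A submodule $N$ of $M$ is graded if $N=\bigoplus_{g}(N\cap M_g)$. $(N:_R M)=\{r\in R: rM\subseteq N\}$. A graded homomorphism $\varphi:M\to M'$ is an $R$-module homomorphism with $\varphi(M_g)\subseteq M'_g$ for all $g\in G$; a graded epimorphism is a surjective graded homomorphism. A proper graded submodule $P$ of $M$ is graded prime if whenever $r\in h(R)$, $m\in h(M)$ and $rm\in P$, then $r\in(P:_RM)$ or $m\in P$. The graded radical $\mathrm{Gr}_M(N)$ of a graded submodule $N$ is the intersection of all graded prime submodules of $M$ containing $N$, with $\mathrm{Gr}_M(N)=M$ if there are none. A proper graded submodule $N$ of $M$ is graded primary-like if whenever $r\in h(R)$ and $m\in h(M)$ with $rm\in N$, then either $r\in(N:_RM)$ or $m\in\mathrm{Gr}_M(N)$. *)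

theory Defs
  imports "HOL-Algebra.Module" "HOL-Algebra.AbelCoset"
begin

text \<open>
  \<open>N\<close> is the internal direct sum of the additive subgroups \<open>A i\<close>, \<open>i \<in> I\<close>, of \<open>M\<close>: every element of
  \<open>N\<close> is the sum of exactly one finitely supported family \<open>f\<close> with \<open>f i \<in> A i\<close>, and all such sums
  lie in \<open>N\<close>. Families are extensional (\<open>\<Pi>\<^sub>E\<close>), so that they are determined by their
  values on \<open>I\<close>.
\<close>
definition internal_direct_sum ::
  "('b, 'm) ring_scheme \<Rightarrow> 'i set \<Rightarrow> ('i \<Rightarrow> 'b set) \<Rightarrow> 'b set \<Rightarrow> bool" where
  "internal_direct_sum M I A N \<longleftrightarrow>
     (\<forall>i\<in>I. additive_subgroup (A i) M) \<and>
     bij_betw (\<lambda>f. \<Oplus>\<^bsub>M\<^esub>i\<in>{i \<in> I. f i \<noteq> \<zero>\<^bsub>M\<^esub>}. f i)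
       {f \<in> (\<Pi>\<^sub>E i\<in>I. A i). finite {i \<in> I. f i \<noteq> \<zero>\<^bsub>M\<^esub>}} N"

locale graded_ring = G?: group G + R?: cring R
  for G :: "('g, 'c) monoid_scheme" and R :: "('a, 'r) ring_scheme" and RG :: "'g \<Rightarrow> 'a set" +
  assumes ring_direct_sum: "internal_direct_sum R (carrier G) RG (carrier R)"
    and ring_mult_component:
      "\<lbrakk>g \<in> carrier G; h \<in> carrier G; r \<in> RG g; s \<in> RG h\<rbrakk> \<Longrightarrow> r \<otimes>\<^bsub>R\<^esub> s \<in> RG (g \<otimes>\<^bsub>G\<^esub> h)"

locale graded_module = graded_ring G R RG + module R M
  for G :: "('g, 'c) monoid_scheme" and R :: "('a, 'r) ring_scheme" and RG :: "'g \<Rightarrow> 'a set"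
    and M :: "('a, 'b, 'm) module_scheme" and MG :: "'g \<Rightarrow> 'b set" +
  assumes module_direct_sum: "internal_direct_sum M (carrier G) MG (carrier M)"
    and smult_component:
      "\<lbrakk>g \<in> carrier G; h \<in> carrier G; r \<in> RG g; m \<in> MG h\<rbrakk> \<Longrightarrow> r \<odot>\<^bsub>M\<^esub> m \<in> MG (g \<otimes>\<^bsub>G\<^esub> h)"

definition homogeneous :: "('g, 'c) monoid_scheme \<Rightarrow> ('g \<Rightarrow> 'b set) \<Rightarrow> 'b set" where
  "homogeneous G A = (\<Union>g\<in>carrier G. A g)"

definition module_colon ::
  "('a, 'r) ring_scheme \<Rightarrow> ('a, 'b, 'm) module_scheme \<Rightarrow> 'b set \<Rightarrow> 'a set" where
  "module_colon R M N = {r \<in> carrier R. \<forall>m\<in>carrier M. r \<odot>\<^bsub>M\<^esub> m \<in> N}"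

definition graded_submodule ::
  "('g, 'c) monoid_scheme \<Rightarrow> ('a, 'r) ring_scheme \<Rightarrow> ('a, 'b, 'm) module_scheme
    \<Rightarrow> ('g \<Rightarrow> 'b set) \<Rightarrow> 'b set \<Rightarrow> bool" where
  "graded_submodule G R M MG N \<longleftrightarrow>
     submodule N R M \<and> internal_direct_sum M (carrier G) (\<lambda>g. N \<inter> MG g) N"

definition graded_prime ::
  "('g, 'c) monoid_scheme \<Rightarrow> ('a, 'r) ring_scheme \<Rightarrow> ('g \<Rightarrow> 'a set) \<Rightarrow> ('a, 'b, 'm) module_scheme
    \<Rightarrow> ('g \<Rightarrow> 'b set) \<Rightarrow> 'b set \<Rightarrow> bool" where
  "graded_prime G R RG M MG P \<longleftrightarrow>
     graded_submodule G R M MG P \<and> P \<noteq> carrier M \<and>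
     (\<forall>r\<in>homogeneous G RG. \<forall>m\<in>homogeneous G MG.
        r \<odot>\<^bsub>M\<^esub> m \<in> P \<longrightarrow> r \<in> module_colon R M P \<or> m \<in> P)"

definition graded_radical ::
  "('g, 'c) monoid_scheme \<Rightarrow> ('a, 'r) ring_scheme \<Rightarrow> ('g \<Rightarrow> 'a set) \<Rightarrow> ('a, 'b, 'm) module_scheme
    \<Rightarrow> ('g \<Rightarrow> 'b set) \<Rightarrow> 'b set \<Rightarrow> 'b set" where
  "graded_radical G R RG M MG N =
     (if \<exists>P. graded_prime G R RG M MG P \<and> N \<subseteq> P
      then \<Inter>{P. graded_prime G R RG M MG P \<and> N \<subseteq> P}
      else carrier M)"

definition graded_primary_like ::
  "('g, 'c) monoid_scheme \<Rightarrow> ('a, 'r) ring_scheme \<Rightarrow> ('g \<Rightarrow> 'a set) \<Rightarrow> ('a, 'b, 'm) module_scheme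
    \<Rightarrow> ('g \<Rightarrow> 'b set) \<Rightarrow> 'b set \<Rightarrow> bool" where
  "graded_primary_like G R RG M MG N \<longleftrightarrow>
     graded_submodule G R M MG N \<and> N \<noteq> carrier M \<and>
     (\<forall>r\<in>homogeneous G RG. \<forall>m\<in>homogeneous G MG.
        r \<odot>\<^bsub>M\<^esub> m \<in> N \<longrightarrow> r \<in> module_colon R M N \<or> m \<in> graded_radical G R RG M MG N)"

definition graded_hom ::
  "('g, 'c) monoid_scheme \<Rightarrow> ('a, 'r) ring_scheme \<Rightarrow> ('a, 'b, 'm) module_scheme
    \<Rightarrow> ('g \<Rightarrow> 'b set) \<Rightarrow> ('a, 'd, 'n) module_scheme \<Rightarrow> ('g \<Rightarrow> 'd set) \<Rightarrow> ('b \<Rightarrow> 'd) \<Rightarrow> bool" where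
  "graded_hom G R M MG M' MG' \<phi> \<longleftrightarrow>
     \<phi> \<in> hom (add_monoid M) (add_monoid M') \<and>
     (\<forall>r\<in>carrier R. \<forall>m\<in>carrier M. \<phi> (r \<odot>\<^bsub>M\<^esub> m) = r \<odot>\<^bsub>M'\<^esub> \<phi> m) \<and>
     (\<forall>g\<in>carrier G. \<phi> ` MG g \<subseteq> MG' g)"

definition graded_epi ::
  "('g, 'c) monoid_scheme \<Rightarrow> ('a, 'r) ring_scheme \<Rightarrow> ('a, 'b, 'm) module_scheme
    \<Rightarrow> ('g \<Rightarrow> 'b set) \<Rightarrow> ('a, 'd, 'n) module_scheme \<Rightarrow> ('g \<Rightarrow> 'd set) \<Rightarrow> ('b \<Rightarrow> 'd) \<Rightarrow> bool" where
  "graded_epi G R M MG M' MG' \<phi> \<longleftrightarrow>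
     graded_hom G R M MG M' MG' \<phi> \<and> \<phi> ` carrier M = carrier M'"

end

theory Submission
  imports Defs
begin

text \<open>
  Write \<open>N = \<phi>\<inverse>(N')\<close>. A graded map sends the homogeneous components of \<open>x\<close> to those of \<open>\<phi> x\<close>,
  because decompositions into components are unique. This single observation transports
  gradedness in both directions: preimages of graded submodules are graded, images of graded
  submodules are graded, and, when \<open>\<phi>\<close> is onto, every homogeneous element of \<open>M'\<close> already is the
  image of a homogeneous element of the same degree.

  Now let \<open>r\<close> and \<open>m\<close> be homogeneous with \<open>r m \<in> N\<close>. Then \<open>r (\<phi> m) \<in> N'\<close>, so that either
  \<open>r M' \<subseteq> N'\<close>, which gives \<open>r M \<subseteq> N\<close> at once, or \<open>\<phi> m\<close> lies in the graded radical of \<open>N'\<close>. In the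
  second case let \<open>P\<close> be a graded prime submodule containing \<open>N\<close>. Since \<open>N\<close> contains the kernel
  of \<open>\<phi>\<close>, so does \<open>P\<close>, whence \<open>P\<close> is the full preimage of \<open>\<phi>(P)\<close> (\<open>image_mem_iff\<close>). Therefore
  \<open>\<phi>(P)\<close> is again graded prime (\<open>graded_prime_image\<close>), and it contains \<open>N'\<close>; hence it contains
  \<open>\<phi> m\<close>, that is, \<open>m \<in> P\<close>. As \<open>P\<close> was arbitrary, \<open>m\<close> lies in the graded radical of \<open>N\<close>.
\<close>

section \<open>Decompositions into homogeneous components\<close>

definition decomposition ::
  "('b, 'm) ring_scheme \<Rightarrow> 'i set \<Rightarrow> ('i \<Rightarrow> 'b set) \<Rightarrow> 'b \<Rightarrow> ('i \<Rightarrow> 'b) \<Rightarrow> bool" where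
  "decomposition M I A x f \<longleftrightarrow>
     f \<in> (\<Pi>\<^sub>E i\<in>I. A i) \<and> finite {i \<in> I. f i \<noteq> \<zero>\<^bsub>M\<^esub>} \<and>
     (\<Oplus>\<^bsub>M\<^esub>i\<in>{i \<in> I. f i \<noteq> \<zero>\<^bsub>M\<^esub>}. f i) = x"

lemma bij_betw_iff_unique_preimage:
  "bij_betw s F N \<longleftrightarrow>
     (\<forall>x f. f \<in> F \<and> s f = x \<longrightarrow> x \<in> N) \<and>
     (\<forall>x\<in>N. \<exists>f. f \<in> F \<and> s f = x) \<and>
     (\<forall>x f f'. f \<in> F \<and> s f = x \<longrightarrow> f' \<in> F \<and> s f' = x \<longrightarrow> f = f')"
proof -
  have "s ` F = N \<longleftrightarrow> (\<forall>x f. f \<in> F \<and> s f = x \<longrightarrow> x \<in> N) \<and> (\<forall>x\<in>N. \<exists>f. f \<in> F \<and> s f = x)"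
    unfolding set_eq_subset subset_iff image_iff by metis
  moreover have "inj_on s F \<longleftrightarrow>
      (\<forall>x f f'. f \<in> F \<and> s f = x \<longrightarrow> f' \<in> F \<and> s f' = x \<longrightarrow> f = f')"
    unfolding inj_on_def by metis
  ultimately show ?thesis unfolding bij_betw_def by argo
qed

lemma internal_direct_sum_iff:
  "internal_direct_sum M I A N \<longleftrightarrow>
     (\<forall>i\<in>I. additive_subgroup (A i) M) \<and>
     (\<forall>x f. decomposition M I A x f \<longrightarrow> x \<in> N) \<and>
     (\<forall>x\<in>N. \<exists>f. decomposition M I A x f) \<and>
     (\<forall>x f f'. decomposition M I A x f \<longrightarrow> decomposition M I A x f' \<longrightarrow> f = f')"
proof -
  have dec: "decomposition M I A x f \<longleftrightarrow>
      f \<in> {f \<in> (\<Pi>\<^sub>E i\<in>I. A i). finite {i \<in> I. f i \<noteq> \<zero>\<^bsub>M\<^esub>}} \<and>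
      (\<Oplus>\<^bsub>M\<^esub>i\<in>{i \<in> I. f i \<noteq> \<zero>\<^bsub>M\<^esub>}. f i) = x" for x f
    unfolding decomposition_def by simp
  show ?thesis unfolding internal_direct_sum_def bij_betw_iff_unique_preimage dec by (rule refl)
qed

lemma decomposition_Int_iff:
  "decomposition M I (\<lambda>i. N \<inter> A i) x f \<longleftrightarrow> decomposition M I A x f \<and> (\<forall>i\<in>I. f i \<in> N)"
  unfolding decomposition_def by (auto simp: PiE_iff)

lemma (in module) finsum_in_submodule:
  assumes "submodule N R M" and "finite I" and "\<And>i. i \<in> I \<Longrightarrow> f i \<in> N"
  shows "(\<Oplus>\<^bsub>M\<^esub>i\<in>I. f i) \<in> N"
proof -
  interpret N: submodule N R M by fact
  have zero: "\<zero>\<^bsub>M\<^esub> \<in> N" using N.one_closed by simp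
  show ?thesis using \<open>finite I\<close> assms(3)
  proof (induction I)
    case empty
    show ?case by (simp add: zero)
  next
    case (insert i I)
    have "f \<in> I \<rightarrow> carrier M" "f i \<in> carrier M" using insert.prems N.subset by auto
    then show ?case
      using insert submoduleE(5)[OF assms(1)] by (simp add: M.finsum_insert)
  qed
qed

lemma (in graded_module) ex_decomposition:
  "x \<in> carrier M \<Longrightarrow> \<exists>f. decomposition M (carrier G) MG x f"
  using module_direct_sum unfolding internal_direct_sum_iff by blast

lemma (in graded_module) decomposition_unique:
  "decomposition M (carrier G) MG x f \<Longrightarrow> decomposition M (carrier G) MG x f' \<Longrightarrow> f = f'"
  using module_direct_sum unfolding internal_direct_sum_iff by blast

lemma (in graded_module) additive_subgroup_component:
  "g \<in> carrier G \<Longrightarrow> additive_subgroup (MG g) M"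
  using module_direct_sum unfolding internal_direct_sum_iff by blast

text \<open>
  A graded submodule is one that contains the components of each of its elements, where the
  components are those taken in the ambient module. This form avoids the change of families from
  \<open>MG g\<close> to \<open>N \<inter> MG g\<close> and is the one used throughout.
\<close>
lemma (in graded_module) graded_submodule_iff:
  "graded_submodule G R M MG N \<longleftrightarrow>
     submodule N R M \<and>
     (\<forall>x\<in>N. \<forall>f. decomposition M (carrier G) MG x f \<longrightarrow> (\<forall>g\<in>carrier G. f g \<in> N))"
    (is "?lhs \<longleftrightarrow> ?sub \<and> ?comp")
proof
  assume lhs: ?lhs
  have "f g \<in> N"
    if x: "x \<in> N" and f: "decomposition M (carrier G) MG x f" and g: "g \<in> carrier G" for x f g
  proof -
    obtain f' where f': "decomposition M (carrier G) (\<lambda>g. N \<inter> MG g) x f'"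
      using lhs x unfolding graded_submodule_def internal_direct_sum_iff by blast
    then have "f' = f" using f decomposition_unique unfolding decomposition_Int_iff by blast
    with f' g show ?thesis unfolding decomposition_Int_iff by blast
  qed
  with lhs show "?sub \<and> ?comp" unfolding graded_submodule_def by blast
next
  assume asm: "?sub \<and> ?comp"
  then interpret N: submodule N R M by blast
  have N_sub: "N \<subseteq> carrier M" using N.subset by simp
  show ?lhs
    unfolding graded_submodule_def internal_direct_sum_iff
  proof (intro conjI ballI allI impI)
    show "submodule N R M" using asm by blast
    show "additive_subgroup (N \<inter> MG g) M" if "g \<in> carrier G" for g
      using additive_subgroup_component[OF that] M.add.subgroups_Inter_pair[OF N.subgroup_axioms]
      by (simp add: additive_subgroup_def)
    show "x \<in> N" if "decomposition M (carrier G) (\<lambda>g. N \<inter> MG g) x f" for x f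
    proof -
      let ?S = "{g \<in> carrier G. f g \<noteq> \<zero>\<^bsub>M\<^esub>}"
      have "finite ?S" "(\<Oplus>\<^bsub>M\<^esub>g\<in>?S. f g) = x" and "\<And>g. g \<in> ?S \<Longrightarrow> f g \<in> N"
        using that unfolding decomposition_def by auto
      then show ?thesis using finsum_in_submodule[OF N.submodule_axioms, of ?S f] by simp
    qed
    show "\<exists>f. decomposition M (carrier G) (\<lambda>g. N \<inter> MG g) x f" if x: "x \<in> N" for x
    proof -
      obtain f where "decomposition M (carrier G) MG x f" using ex_decomposition x N_sub by blast
      with asm x show ?thesis unfolding decomposition_Int_iff by blast
    qed
    show "f = f'" if "decomposition M (carrier G) (\<lambda>g. N \<inter> MG g) x f"
      "decomposition M (carrier G) (\<lambda>g. N \<inter> MG g) x f'" for x f f'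
      using that decomposition_unique unfolding decomposition_Int_iff by blast
  qed
qed

lemma (in graded_module) component_closed:
  "g \<in> carrier G \<Longrightarrow> m \<in> MG g \<Longrightarrow> m \<in> carrier M"
  using additive_subgroup_component additive_subgroup.a_subset by blast

lemma (in graded_ring) homogeneous_ring_closed:
  "r \<in> homogeneous G RG \<Longrightarrow> r \<in> carrier R"
  using ring_direct_sum additive_subgroup.a_subset
  unfolding internal_direct_sum_iff homogeneous_def by blast

text \<open>
  The default value \<open>carrier M\<close> of the graded radical is absorbed by the condition
  \<open>m \<in> carrier M\<close>, since every graded prime submodule is a subset of the carrier.
\<close>
lemma (in graded_module) mem_graded_radical_iff:
  "m \<in> graded_radical G R RG M MG N \<longleftrightarrow>
     m \<in> carrier M \<and> (\<forall>P. graded_prime G R RG M MG P \<longrightarrow> N \<subseteq> P \<longrightarrow> m \<in> P)"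
proof -
  have "P \<subseteq> carrier M" if "graded_prime G R RG M MG P" for P
    using that submoduleE(1) unfolding graded_prime_def graded_submodule_def by blast
  then show ?thesis unfolding graded_radical_def by auto
qed

section \<open>Graded epimorphisms\<close>

locale graded_epimorphism =
  A: graded_module G R RG M MG + B: graded_module G R RG M' MG'
  for G :: "('g, 'c) monoid_scheme" and R :: "('a, 'r) ring_scheme" and RG :: "'g \<Rightarrow> 'a set"
    and M :: "('a, 'b, 'm) module_scheme" and MG :: "'g \<Rightarrow> 'b set"
    and M' :: "('a, 'd, 'n) module_scheme" and MG' :: "'g \<Rightarrow> 'd set" +
  fixes \<phi> :: "'b \<Rightarrow> 'd"
  assumes epi: "graded_epi G R M MG M' MG' \<phi>"
begin

sublocale hom: abelian_group_hom M M' \<phi>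
proof (rule abelian_group_homI)
  show "group_hom (add_monoid M) (add_monoid M') \<phi>"
    using epi A.M.a_group B.M.a_group
    by (simp add: graded_epi_def graded_hom_def group_hom_def group_hom_axioms_def)
qed unfold_locales

lemma map_smult: "r \<in> carrier R \<Longrightarrow> m \<in> carrier M \<Longrightarrow> \<phi> (r \<odot>\<^bsub>M\<^esub> m) = r \<odot>\<^bsub>M'\<^esub> \<phi> m"
  and map_component: "g \<in> carrier G \<Longrightarrow> m \<in> MG g \<Longrightarrow> \<phi> m \<in> MG' g"
  using epi unfolding graded_epi_def graded_hom_def by blast+

lemma map_surj:
  assumes "y \<in> carrier M'"
  obtains x where "x \<in> carrier M" and "\<phi> x = y"
proof -
  have "y \<in> \<phi> ` carrier M" using assms epi unfolding graded_epi_def by simp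
  with that show thesis by blast
qed

lemma map_finsum:
  assumes "finite I" and "f \<in> I \<rightarrow> carrier M"
  shows "\<phi> (\<Oplus>\<^bsub>M\<^esub>i\<in>I. f i) = (\<Oplus>\<^bsub>M'\<^esub>i\<in>I. \<phi> (f i))"
  using assms
proof (induction I)
  case empty
  show ?case by simp
next
  case (insert i I)
  then have "f \<in> I \<rightarrow> carrier M" "f i \<in> carrier M" "(\<lambda>i. \<phi> (f i)) \<in> I \<rightarrow> carrier M'"
    by (auto simp: Pi_iff)
  with insert show ?case by (simp add: A.M.finsum_insert B.M.finsum_insert)
qed

text \<open>
  The support can shrink under \<open>\<phi>\<close>, so the sum of the images has to be restricted to the smaller
  support; the terms that are dropped vanish.
\<close>
lemma map_decomposition:
  assumes "decomposition M (carrier G) MG x f"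
  shows "decomposition M' (carrier G) MG' (\<phi> x) (\<lambda>g\<in>carrier G. \<phi> (f g))"
proof -
  let ?S = "{g \<in> carrier G. f g \<noteq> \<zero>\<^bsub>M\<^esub>}"
  let ?f' = "\<lambda>g\<in>carrier G. \<phi> (f g)"
  let ?S' = "{g \<in> carrier G. ?f' g \<noteq> \<zero>\<^bsub>M'\<^esub>}"
  have fin: "finite ?S" and x: "(\<Oplus>\<^bsub>M\<^esub>g\<in>?S. f g) = x"
    and f: "\<And>g. g \<in> carrier G \<Longrightarrow> f g \<in> MG g"
    using assms unfolding decomposition_def by auto
  have sub: "?S' \<subseteq> ?S" by auto
  have car: "f g \<in> carrier M" if "g \<in> carrier G" for g
    using that f A.component_closed by blast
  have "(\<Oplus>\<^bsub>M'\<^esub>g\<in>?S'. ?f' g) = (\<Oplus>\<^bsub>M'\<^esub>g\<in>?S. \<phi> (f g))"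
    by (rule B.M.add.finprod_mono_neutral_cong_left[OF fin sub]) (use car in auto)
  also have "\<dots> = \<phi> x"
    unfolding x[symmetric] by (rule map_finsum[OF fin, symmetric]) (use car in auto)
  finally have "(\<Oplus>\<^bsub>M'\<^esub>g\<in>?S'. ?f' g) = \<phi> x" .
  moreover have "?f' \<in> (\<Pi>\<^sub>E g\<in>carrier G. MG' g)" using f map_component by auto
  ultimately show ?thesis using finite_subset[OF sub fin] unfolding decomposition_def by blast
qed

lemma decomposition_map_eq:
  assumes "decomposition M (carrier G) MG x f"
    and "decomposition M' (carrier G) MG' (\<phi> x) f'" and "g \<in> carrier G"
  shows "f' g = \<phi> (f g)"
proof -
  have "f' = (\<lambda>g\<in>carrier G. \<phi> (f g))"
    using assms(2) map_decomposition[OF assms(1)] by (rule B.decomposition_unique)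
  with assms(3) show ?thesis by simp
qed

text \<open>
  The decomposition of a homogeneous element is concentrated in its degree, so the component in
  that degree of an arbitrary preimage is a preimage.
\<close>
lemma map_component_surj:
  assumes g: "g \<in> carrier G" and y: "y \<in> MG' g"
  obtains m where "m \<in> MG g" and "\<phi> m = y"
proof -
  have yc: "y \<in> carrier M'" using B.component_closed[OF g y] .
  then obtain x where x: "x \<in> carrier M" "\<phi> x = y" by (rule map_surj)
  then obtain f where f: "decomposition M (carrier G) MG x f" using A.ex_decomposition by blast
  let ?f' = "\<lambda>h\<in>carrier G. if h = g then y else \<zero>\<^bsub>M'\<^esub>"
  have zero: "\<zero>\<^bsub>M'\<^esub> \<in> MG' h" if "h \<in> carrier G" for h
    using that by (rule additive_subgroup.zero_closed[OF B.additive_subgroup_component])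
  let ?S' = "{h \<in> carrier G. ?f' h \<noteq> \<zero>\<^bsub>M'\<^esub>}"
  have S': "?S' = (if y = \<zero>\<^bsub>M'\<^esub> then {} else {g})"
    using g by auto
  have "?f' \<in> (\<Pi>\<^sub>E h\<in>carrier G. MG' h)" using y zero by auto
  moreover have "finite ?S'" unfolding S' by simp
  moreover have "(\<Oplus>\<^bsub>M'\<^esub>h\<in>?S'. ?f' h) = y"
    unfolding S' using g yc by (auto simp: B.M.finsum_insert)
  ultimately have "decomposition M' (carrier G) MG' y ?f'"
    unfolding decomposition_def by blast
  then have "\<phi> (f g) = y"
    using decomposition_map_eq[OF f _ g, of ?f'] x(2) g by simp
  moreover have "f g \<in> MG g" using f g unfolding decomposition_def by auto
  ultimately show thesis using that by blast
qed

lemma submodule_vimage: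
  assumes "submodule N' R M'"
  shows "submodule (\<phi> -` N' \<inter> carrier M) R M"
proof -
  interpret N': submodule N' R M' by fact
  note N' = B.submoduleE[OF assms]
  have zero: "\<zero>\<^bsub>M'\<^esub> \<in> N'" using N'.one_closed by simp
  show ?thesis
  proof (rule A.submoduleI)
    show "\<phi> -` N' \<inter> carrier M \<subseteq> carrier M" by simp
    show "\<zero>\<^bsub>M\<^esub> \<in> \<phi> -` N' \<inter> carrier M" using zero by simp
    show "\<ominus>\<^bsub>M\<^esub> a \<in> \<phi> -` N' \<inter> carrier M" if "a \<in> \<phi> -` N' \<inter> carrier M" for a
      using that N'(3)[of "\<phi> a"] by simp
    show "a \<oplus>\<^bsub>M\<^esub> b \<in> \<phi> -` N' \<inter> carrier M"
      if "a \<in> \<phi> -` N' \<inter> carrier M" "b \<in> \<phi> -` N' \<inter> carrier M" for a b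
      using that N'(5)[of "\<phi> a" "\<phi> b"] by simp
    show "r \<odot>\<^bsub>M\<^esub> a \<in> \<phi> -` N' \<inter> carrier M"
      if "r \<in> carrier R" "a \<in> \<phi> -` N' \<inter> carrier M" for r a
      using that N'(4)[of r "\<phi> a"] by (simp add: map_smult)
  qed
qed

lemma submodule_image:
  assumes "submodule P R M"
  shows "submodule (\<phi> ` P) R M'"
proof -
  interpret P: submodule P R M by fact
  note P = A.submoduleE[OF assms]
  have zero: "\<zero>\<^bsub>M\<^esub> \<in> P" using P.one_closed by simp
  show ?thesis
  proof (rule B.submoduleI)
    show "\<phi> ` P \<subseteq> carrier M'"
      by (rule image_subsetI) (rule hom.hom_closed[OF subsetD[OF P(1)]])
    show "\<zero>\<^bsub>M'\<^esub> \<in> \<phi> ` P" using imageI[OF zero, of \<phi>] by simp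
    show "\<ominus>\<^bsub>M'\<^esub> a \<in> \<phi> ` P" if a: "a \<in> \<phi> ` P" for a
    proof -
      obtain p where p: "a = \<phi> p" "p \<in> P" using a by (rule imageE)
      then have "\<phi> (\<ominus>\<^bsub>M\<^esub> p) = \<ominus>\<^bsub>M'\<^esub> a" using subsetD[OF P(1)] by simp
      with imageI[OF P(3)[OF p(2)], of \<phi>] show ?thesis by simp
    qed
    show "a \<oplus>\<^bsub>M'\<^esub> b \<in> \<phi> ` P" if a: "a \<in> \<phi> ` P" and b: "b \<in> \<phi> ` P" for a b
    proof -
      obtain p where p: "a = \<phi> p" "p \<in> P" using a by (rule imageE)
      obtain q where q: "b = \<phi> q" "q \<in> P" using b by (rule imageE)
      have "\<phi> (p \<oplus>\<^bsub>M\<^esub> q) = a \<oplus>\<^bsub>M'\<^esub> b" using p q subsetD[OF P(1)] by simp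
      with imageI[OF P(5)[OF p(2) q(2)], of \<phi>] show ?thesis by simp
    qed
    show "r \<odot>\<^bsub>M'\<^esub> a \<in> \<phi> ` P" if r: "r \<in> carrier R" and a: "a \<in> \<phi> ` P" for r a
    proof -
      obtain p where p: "a = \<phi> p" "p \<in> P" using a by (rule imageE)
      then have "\<phi> (r \<odot>\<^bsub>M\<^esub> p) = r \<odot>\<^bsub>M'\<^esub> a" using subsetD[OF P(1)] map_smult[OF r] by simp
      with imageI[OF P(4)[OF r p(2)], of \<phi>] show ?thesis by simp
    qed
  qed
qed

lemma graded_submodule_vimage:
  assumes "graded_submodule G R M' MG' N'"
  shows "graded_submodule G R M MG (\<phi> -` N' \<inter> carrier M)"
  unfolding A.graded_submodule_iff
proof (intro conjI ballI allI impI)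
  show "submodule (\<phi> -` N' \<inter> carrier M) R M"
    using assms submodule_vimage unfolding graded_submodule_def by blast
next
  fix x f g
  assume x: "x \<in> \<phi> -` N' \<inter> carrier M" and f: "decomposition M (carrier G) MG x f"
    and g: "g \<in> carrier G"
  have "(\<lambda>g\<in>carrier G. \<phi> (f g)) g \<in> N'"
    using assms x g map_decomposition[OF f] unfolding B.graded_submodule_iff by blast
  moreover have "f g \<in> carrier M"
    using f g A.component_closed unfolding decomposition_def by blast
  ultimately show "f g \<in> \<phi> -` N' \<inter> carrier M" using g by simp
qed

lemma graded_submodule_image:
  assumes "graded_submodule G R M MG P"
  shows "graded_submodule G R M' MG' (\<phi> ` P)"
  unfolding B.graded_submodule_iff
proof (intro conjI ballI allI impI)
  show "submodule (\<phi> ` P) R M'"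
    using assms submodule_image unfolding graded_submodule_def by blast
next
  fix y f' g
  assume y: "y \<in> \<phi> ` P" and f': "decomposition M' (carrier G) MG' y f'" and g: "g \<in> carrier G"
  from y obtain p where p: "y = \<phi> p" "p \<in> P" by (rule imageE)
  moreover have "p \<in> carrier M"
    using assms p(2) A.submoduleE(1) unfolding graded_submodule_def by blast
  ultimately obtain f where f: "decomposition M (carrier G) MG p f"
    using A.ex_decomposition by blast
  have "f g \<in> P" using assms p(2) f g unfolding A.graded_submodule_iff by blast
  then show "f' g \<in> \<phi> ` P" using decomposition_map_eq[OF f _ g] f' p(1) by blast
qed

text \<open>
  Two elements with the same image differ by an element of the kernel.
\<close>
lemma image_mem_iff:
  assumes P: "submodule P R M"
    and ker: "\<And>x. x \<in> carrier M \<Longrightarrow> \<phi> x = \<zero>\<^bsub>M'\<^esub> \<Longrightarrow> x \<in> P"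
    and x: "x \<in> carrier M"
  shows "\<phi> x \<in> \<phi> ` P \<longleftrightarrow> x \<in> P"
proof
  assume "\<phi> x \<in> \<phi> ` P"
  then obtain p where p: "\<phi> x = \<phi> p" "p \<in> P" by (rule imageE)
  have pc: "p \<in> carrier M" using A.submoduleE(1)[OF P] p(2) by blast
  have "\<phi> (x \<oplus>\<^bsub>M\<^esub> \<ominus>\<^bsub>M\<^esub> p) = \<zero>\<^bsub>M'\<^esub>" using x pc p(1) by (simp add: B.M.r_neg)
  then have "x \<oplus>\<^bsub>M\<^esub> \<ominus>\<^bsub>M\<^esub> p \<in> P" using ker x pc by simp
  then have "(x \<oplus>\<^bsub>M\<^esub> \<ominus>\<^bsub>M\<^esub> p) \<oplus>\<^bsub>M\<^esub> p \<in> P" using A.submoduleE(5)[OF P] p(2) by blast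
  then show "x \<in> P" using x pc by (simp add: A.M.a_assoc A.M.l_neg)
qed (rule imageI)

text \<open>
  Properness and the prime condition are both checked on lifts to \<open>M\<close>. A homogeneous element has a
  homogeneous lift, and membership of an image in \<open>\<phi>(P)\<close> is membership in \<open>P\<close>, since \<open>P\<close> contains
  the kernel.
\<close>
lemma graded_prime_image:
  assumes prime: "graded_prime G R RG M MG P"
    and ker: "\<And>x. x \<in> carrier M \<Longrightarrow> \<phi> x = \<zero>\<^bsub>M'\<^esub> \<Longrightarrow> x \<in> P"
  shows "graded_prime G R RG M' MG' (\<phi> ` P)"
  unfolding graded_prime_def
proof (intro conjI ballI impI)
  have gr: "graded_submodule G R M MG P" using prime unfolding graded_prime_def by blast
  then have P: "submodule P R M" unfolding graded_submodule_def by blast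
  show "graded_submodule G R M' MG' (\<phi> ` P)" using gr by (rule graded_submodule_image)
  show "\<phi> ` P \<noteq> carrier M'"
  proof
    assume "\<phi> ` P = carrier M'"
    then have "carrier M \<subseteq> P" using image_mem_iff[OF P ker] hom.hom_closed by blast
    then show False using prime A.submoduleE(1)[OF P] unfolding graded_prime_def by blast
  qed
  fix r m'
  assume r: "r \<in> homogeneous G RG" and m': "m' \<in> homogeneous G MG'"
    and rm': "r \<odot>\<^bsub>M'\<^esub> m' \<in> \<phi> ` P"
  have rc: "r \<in> carrier R" using r by (rule A.homogeneous_ring_closed)
  obtain g m where m: "g \<in> carrier G" "m \<in> MG g" "\<phi> m = m'"
    using m' map_component_surj unfolding homogeneous_def by blast
  then have mc: "m \<in> carrier M" using A.component_closed by blast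
  have "\<phi> (r \<odot>\<^bsub>M\<^esub> m) \<in> \<phi> ` P" using rm' m(3) map_smult[OF rc mc] by simp
  then have "r \<odot>\<^bsub>M\<^esub> m \<in> P" using image_mem_iff[OF P ker] rc mc by simp
  then have "r \<in> module_colon R M P \<or> m \<in> P"
    using prime r m(1,2) unfolding graded_prime_def homogeneous_def by blast
  then show "r \<in> module_colon R M' (\<phi> ` P) \<or> m' \<in> \<phi> ` P"
  proof
    assume "r \<in> module_colon R M P"
    then have "r \<odot>\<^bsub>M'\<^esub> \<phi> x \<in> \<phi> ` P" if "x \<in> carrier M" for x
      using that map_smult[OF rc that, symmetric] unfolding module_colon_def by simp
    then show ?thesis using rc unfolding module_colon_def by (auto elim: map_surj)
  next
    assume "m \<in> P"
    then show ?thesis using m(3) by blast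
  qed
qed

text \<open>
  A graded prime submodule that contains \<open>\<phi>\<inverse>(N')\<close> contains the kernel, so its image is a graded
  prime submodule containing \<open>N'\<close>.
\<close>
lemma graded_radical_vimage:
  assumes N': "submodule N' R M'" and m: "m \<in> carrier M"
    and rad: "\<phi> m \<in> graded_radical G R RG M' MG' N'"
  shows "m \<in> graded_radical G R RG M MG (\<phi> -` N' \<inter> carrier M)"
  unfolding A.mem_graded_radical_iff
proof (intro conjI allI impI)
  show "m \<in> carrier M" by fact
  fix P
  assume prime: "graded_prime G R RG M MG P" and NP: "\<phi> -` N' \<inter> carrier M \<subseteq> P"
  have P: "submodule P R M" using prime unfolding graded_prime_def graded_submodule_def by blast
  interpret N': submodule N' R M' by fact
  have ker: "x \<in> P" if "x \<in> carrier M" "\<phi> x = \<zero>\<^bsub>M'\<^esub>" for x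
    using that N'.one_closed NP by auto
  have "N' \<subseteq> \<phi> ` P"
  proof
    fix y assume y: "y \<in> N'"
    then have "y \<in> carrier M'" using B.submoduleE(1)[OF N'] by blast
    then obtain x where "x \<in> carrier M" "\<phi> x = y" by (rule map_surj)
    with y NP show "y \<in> \<phi> ` P" by blast
  qed
  then have "\<phi> m \<in> \<phi> ` P"
    using rad graded_prime_image[OF prime ker] unfolding B.mem_graded_radical_iff by blast
  then show "m \<in> P" using image_mem_iff[OF P ker m] by blast
qed

end

section \<open>Preimages of graded primary-like submodules\<close>

theorem theorem4p9:
  fixes G :: "('g, 'c) monoid_scheme"
    and R :: "('a, 'r) ring_scheme" and RG :: "'g \<Rightarrow> 'a set"
    and M :: "('a, 'b, 'm) module_scheme" and MG :: "'g \<Rightarrow> 'b set"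
    and M' :: "('a, 'd, 'n) module_scheme" and MG' :: "'g \<Rightarrow> 'd set"
    and N' :: "'d set" and \<phi> :: "'b \<Rightarrow> 'd"
  assumes "group G"
    and "graded_ring G R RG"
    and "graded_module G R RG M MG"
    and "graded_module G R RG M' MG'"
    and "graded_submodule G R M' MG' N'"
    and "graded_epi G R M MG M' MG' \<phi>"
    and "graded_primary_like G R RG M' MG' N'"
  shows "graded_primary_like G R RG M MG (\<phi> -` N' \<inter> carrier M)"
proof -
  interpret graded_epimorphism G R RG M MG M' MG' \<phi>
    using assms(3,4,6) by (intro graded_epimorphism.intro graded_epimorphism_axioms.intro)
  let ?N = "\<phi> -` N' \<inter> carrier M"
  have N': "submodule N' R M'" using assms(5) unfolding graded_submodule_def by blast
  show ?thesis
    unfolding graded_primary_like_def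
  proof (intro conjI ballI impI)
    show "graded_submodule G R M MG ?N" using assms(5) by (rule graded_submodule_vimage)
    show "?N \<noteq> carrier M"
    proof
      assume "?N = carrier M"
      then have "carrier M' \<subseteq> N'" by (auto elim: map_surj)
      then show False
        using assms(7) B.submoduleE(1)[OF N'] unfolding graded_primary_like_def by blast
    qed
    fix r m
    assume r: "r \<in> homogeneous G RG" and m: "m \<in> homogeneous G MG" and rm: "r \<odot>\<^bsub>M\<^esub> m \<in> ?N"
    have rc: "r \<in> carrier R" using r by (rule A.homogeneous_ring_closed)
    have mc: "m \<in> carrier M" using m A.component_closed unfolding homogeneous_def by blast
    have "\<phi> m \<in> homogeneous G MG'" using m map_component unfolding homogeneous_def by blast
    moreover have "r \<odot>\<^bsub>M'\<^esub> \<phi> m \<in> N'" using rm map_smult[OF rc mc] by simp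
    ultimately consider "r \<in> module_colon R M' N'"
      | "\<phi> m \<in> graded_radical G R RG M' MG' N'"
      using assms(7) r unfolding graded_primary_like_def by blast
    then show "r \<in> module_colon R M ?N \<or> m \<in> graded_radical G R RG M MG ?N"
    proof cases
      case 1
      then have "r \<in> module_colon R M ?N"
        using rc unfolding module_colon_def by (auto simp: map_smult)
      then show ?thesis ..
    next
      case 2
      then show ?thesis using graded_radical_vimage[OF N' mc] by blast
    qed
  qed
qed

end
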